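(* Consider the changepoint double array described in the context. Suppose (post-change separation) that $F_{P_0}$ and $H$ are continuous, $H(0)=0$, and $\sup_{t\in[0,1]}|H(t)-t|>0$. Suppose also (directional local detectability) that there exist constants $\theta_0>0$, $C<\infty$, $B<\infty$, $c_\Pi>0$, a bounded Lipschitz function $g:[0,1]\to\mathbb R$ and densities $\{f_\theta:|\theta|\le\theta_0\}\subseteq\mathcal F$ such that $f_0\equiv1$, $\int_0^1g(u)\,du=0$, $J:=\int_0^1g\,dH\ne0$; for every $|\theta|\le\theta_0$, $\sup_{u\in[0,1]}|\log f_\theta(u)-\theta g(u)|\le C\theta^2$ and $\sup_{u\in[0,1]}|\frac{\partial}{\partial\theta}\log f_\theta(u)|\le B$; and for all sufficiently small $\epsilon>0$ and all $\theta\in[-\theta_0/2,\theta_0/2]$, $\Pi\{f_\vartheta:|\vartheta-\theta|\le\epsilon\}\ge c_\Pi\epsilon$. Fix $\gamma_0\in(0,\theta_0/2)$ with $I_R:=I(\gamma_0)>0$, where $I(\gamma):=\gamma|J|-C\gamma^2$. Then there exist constants $c_0,c_1,c_2>0$ and $\delta_0\in(0,1)$, depending only on the distributions, the betting family and $\gamma_0$, such that the following holds: for all sufficiently large $n$ and every integer $r$ satisfying $1\le r\le\delta_0T_n$ and $$\frac{I_R}{2}\,r-\log r-c_0\ \ge\ \mathcal B_{n,w}(b_n),$$ we have $$\mathbb P_{P_0,T_n,P_1}\{\tau_{n,S,w}(b_n)>T_n+r\}\le c_1e^{-c_2r},$$ and the same bound holds with $\tau_{n,Z,w}(b_n)$ in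 place of $\tau_{n,S,w}(b_n)$.
   Context: Data: $(T_n)_{n\ge1}$ is an increasing sequence of positive integers with $T_n\to\infty$; $P_0,P_1$ are probability measures on $\mathbb R$. For each $n$, the row $(X_{n,j})_{j\ge1}$ satisfies $X_{n,1},\dots,X_{n,T_n}\stackrel{iid}{\sim}P_0$, $X_{n,T_n+1},X_{n,T_n+2},\dots\stackrel{iid}{\sim}P_1$, the two blocks being independent; randomizers $\lambda_{n,j}\stackrel{iid}{\sim}U(0,1)$ are independent of the array. $\mathbb P_{P_0,T_n,P_1}$ is the law of row $n$ together with its randomizers. Conformal p-values: $p_{n,j}:=\frac1j\big(\sum_{i=1}^j\mathbf 1\{X_{n,i}<X_{n,j}\}+\lambda_{n,j}\sum_{i=1}^j\mathbf 1\{X_{n,i}=X_{n,j}\}\big)$. Detectors: $\mathcal F$ is a (jointly measurably parametrized) family of probability densities on $[0,1]$, $\Pi$ a probability measure on (the parameter space of) $\mathcal F$, $w=(w_k)_{k\ge1}$ a deterministic nonnegative weight sequence, $b_n>0$ deterministic thresholds. For $k\le t$, $M_{n,k,t}:=\int_{\mathcal F}\prod_{j=k}^t f(p_{n,j})\,d\Pi(f)$, $S_{n,t}^{(w)}:=\sum_{k=1}^tw_kM_{n,k,t}$, $Z_{n,t}^{(w)}:=\max_{1\le k\le t}w_kM_{n,k,t}$, $\tau_{n,S,w}(b):=\inf\{t\ge1:S_{n,t}^{(w)}\ge b\}$, $\tau_{n,Z,w}(b):=\inf\{t\ge1:Z_{n,t}^{(w)}\ge b\}$ ($\inf\varnothing=\infty$).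 $\mathcal B_{n,w}(b_n):=\log\frac{b_n}{w_{T_n+1}}$ (with $\log(b/0)=+\infty$). $F_{P_0}$ is the CDF of $P_0$ and $H(t):=\mathbb P_{Y\sim P_1}\{F_{P_0}(Y)\le t\}$, $t\in[0,1]$. *)

theory Defs
  imports "HOL-Probability.Probability"
begin

definition row_law :: "real measure \<Rightarrow> nat \<Rightarrow> real measure \<Rightarrow> ((nat \<Rightarrow> real) \<times> (nat \<Rightarrow> real)) measure" where
  "row_law P0 T P1 =
     PiM {1..} (\<lambda>j. if j \<le> T then P0 else P1) \<Otimes>\<^sub>M
     PiM {1..} (\<lambda>_. uniform_measure lborel {0<..<1})"

definition conformal_p :: "(nat \<Rightarrow> real) \<times> (nat \<Rightarrow> real) \<Rightarrow> nat \<Rightarrow> real" where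
  "conformal_p \<omega> j = (case \<omega> of (x, l) \<Rightarrow>
     1 / real j * ((\<Sum>i=1..j. of_bool (x i < x j)) + l j * (\<Sum>i=1..j. of_bool (x i = x j))))"

(* Densities on [0,1] are functions on the whole line of which only the values on [0,1] matter:
   conformal_p lies in [0,1] almost surely. *)
definition unit_density :: "(real \<Rightarrow> real) \<Rightarrow> bool" where
  "unit_density f \<longleftrightarrow>
     (\<forall>u\<in>{0..1}. 0 \<le> f u) \<and> (\<integral>\<^sup>+u\<in>{0..1}. ennreal (f u) \<partial>lborel) = 1"

(* Q is a mixing measure on the parameter space of the family {f a | a \<in> space Q}. *)
definition betting_family :: "'a measure \<Rightarrow> ('a \<Rightarrow> real \<Rightarrow> real) \<Rightarrow> bool" where
  "betting_family Q f \<longleftrightarrow>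
     prob_space Q \<and> case_prod f \<in> borel_measurable (Q \<Otimes>\<^sub>M borel) \<and>
     (\<forall>a\<in>space Q. unit_density (f a))"

(* The Q-mass of a set G of densities on [0,1], i.e. of the parameters whose density agrees on
   [0,1] with a member of G. *)
definition family_mass :: "'a measure \<Rightarrow> ('a \<Rightarrow> real \<Rightarrow> real) \<Rightarrow> (real \<Rightarrow> real) set \<Rightarrow> real" where
  "family_mass Q f G = measure Q {a \<in> space Q. \<exists>h\<in>G. \<forall>u\<in>{0..1}. f a u = h u}"

(* Extended values: the densities need not be bounded, so the mixture integral may be infinite. *)
definition mixture :: "'a measure \<Rightarrow> ('a \<Rightarrow> real \<Rightarrow> real) \<Rightarrow>
    (nat \<Rightarrow> real) \<times> (nat \<Rightarrow> real) \<Rightarrow> nat \<Rightarrow> nat \<Rightarrow> ennreal" where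
  "mixture Q f \<omega> k t = (\<integral>\<^sup>+a. ennreal (\<Prod>j=k..t. f a (conformal_p \<omega> j)) \<partial>Q)"

definition stat_S :: "'a measure \<Rightarrow> ('a \<Rightarrow> real \<Rightarrow> real) \<Rightarrow> (nat \<Rightarrow> real) \<Rightarrow>
    (nat \<Rightarrow> real) \<times> (nat \<Rightarrow> real) \<Rightarrow> nat \<Rightarrow> ennreal" where
  "stat_S Q f w \<omega> t = (\<Sum>k=1..t. ennreal (w k) * mixture Q f \<omega> k t)"

definition stat_Z :: "'a measure \<Rightarrow> ('a \<Rightarrow> real \<Rightarrow> real) \<Rightarrow> (nat \<Rightarrow> real) \<Rightarrow>
    (nat \<Rightarrow> real) \<times> (nat \<Rightarrow> real) \<Rightarrow> nat \<Rightarrow> ennreal" where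
  "stat_Z Q f w \<omega> t = Max ((\<lambda>k. ennreal (w k) * mixture Q f \<omega> k t) ` {1..t})"

definition tau_S :: "'a measure \<Rightarrow> ('a \<Rightarrow> real \<Rightarrow> real) \<Rightarrow> (nat \<Rightarrow> real) \<Rightarrow> real \<Rightarrow>
    (nat \<Rightarrow> real) \<times> (nat \<Rightarrow> real) \<Rightarrow> enat" where
  "tau_S Q f w b \<omega> = Inf {enat t | t. 1 \<le> t \<and> ennreal b \<le> stat_S Q f w \<omega> t}"

definition tau_Z :: "'a measure \<Rightarrow> ('a \<Rightarrow> real \<Rightarrow> real) \<Rightarrow> (nat \<Rightarrow> real) \<Rightarrow> real \<Rightarrow>
    (nat \<Rightarrow> real) \<times> (nat \<Rightarrow> real) \<Rightarrow> enat" where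
  "tau_Z Q f w b \<omega> = Inf {enat t | t. 1 \<le> t \<and> ennreal b \<le> stat_Z Q f w \<omega> t}"

definition log_barrier :: "(nat \<Rightarrow> real) \<Rightarrow> nat \<Rightarrow> real \<Rightarrow> ereal" where
  "log_barrier w T b = (if w (T + 1) = 0 then \<infinity> else ereal (ln (b / w (T + 1))))"

(* Defined on the whole line, where it is 0 to the left of 0 and 1 to the right of 1; in
   particular interval_measure (rank_cdf P0 P1) is its Lebesgue-Stieltjes measure. *)
definition rank_cdf :: "real measure \<Rightarrow> real measure \<Rightarrow> real \<Rightarrow> real" where
  "rank_cdf P0 P1 t = measure P1 {y \<in> space P1. cdf P0 y \<le> t}"

definition info_rate :: "real \<Rightarrow> real \<Rightarrow> real \<Rightarrow> real" where
  "info_rate J C \<gamma> = \<gamma> * \<bar>J\<bar> - C * \<gamma>\<^sup>2"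

end

theory Submission
  imports Defs
begin

text \<open>
  If the detector is still silent at time \<open>T + r\<close>, then \<open>w (T + 1)\<close> times the mixture started at
  \<open>T + 1\<close> is below \<open>b\<close>. The mixture is bounded below by restricting it to the densities
  \<open>h \<theta>'\<close> with \<open>\<theta>'\<close> within \<open>\<kappa> / r\<close> of \<open>\<theta> = sgn J * \<gamma>0\<close>: these have mass at least \<open>c\<^sub>Q * \<kappa> / r\<close>, which
  costs the term \<open>ln r\<close>, and replacing \<open>h \<theta>'\<close> by \<open>h \<theta>\<close> in the product of \<open>r\<close> factors costs only the
  constant factor \<open>exp (- B * \<kappa>)\<close>. It remains to see that the sum of the \<open>g (p j)\<close> over the \<open>r\<close>
  post-change times is \<open>r * J\<close> up to \<open>r * I\<^sub>R / (2 * \<gamma>0)\<close>. While \<open>r / T\<close> is small, \<open>p j\<close> is close to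
  \<open>cdf P0 (X j)\<close>, uniformly, as soon as the empirical distribution function of the pre-change sample
  is close to \<open>cdf P0\<close> at finitely many quantiles. Hoeffding's inequality, once at these quantiles
  and once for the independent variables \<open>g (cdf P0 (X j))\<close> with mean \<open>J\<close>, bounds the probability of
  failure.
\<close>

section \<open>Concentration under a product measure\<close>

text \<open>Only the coordinates in \<open>A\<close> share a law, so the bound serves the pre-change
  and the post-change block of the same row. A range of length \<open>2 * K\<close> per summand
  turns Hoeffding's exponent \<open>-2 * (n * \<epsilon>)^2 / (n * (2 * K)^2)\<close> into the
  stated one.\<close>

lemma Hoeffding_PiM:
  fixes \<phi> :: "'b \<Rightarrow> real"
  assumes M: "\<And>i. i \<in> I \<Longrightarrow> prob_space (M i)"
    and A: "finite A" "A \<noteq> {}" "A \<subseteq> I" and N: "\<And>i. i \<in> A \<Longrightarrow> M i = N"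
    and \<phi>: "\<phi> \<in> borel_measurable N" "\<And>y. y \<in> space N \<Longrightarrow> \<bar>\<phi> y\<bar> \<le> K"
    and K: "K > 0" and \<epsilon>: "\<epsilon> \<ge> 0"
  shows "measure (PiM I M) {x \<in> space (PiM I M).
      real (card A) * \<epsilon> \<le> \<bar>(\<Sum>i\<in>A. \<phi> (x i)) - real (card A) * (LINT y|N. \<phi> y)\<bar>}
    \<le> 2 * exp (- (\<epsilon>\<^sup>2 / (2 * K\<^sup>2)) * real (card A))"
proof -
  interpret P: prob_space "PiM I M"
    using M by (rule prob_space_PiM)
  have coord: "(\<lambda>x. x i) \<in> measurable (PiM I M) (M i)" if "i \<in> A" for i
    using that A by (intro measurable_component_singleton) auto
  have comp: "distr (PiM I M) (M i) (\<lambda>x. x i) = M i" if "i \<in> A" for i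
    using that A by (intro distr_PiM_component M) auto
  \<comment> \<open>Independence is read off from the joint law: restriction to \<open>A\<close> is
    reindexing along the identity, so its law is again the product of the marginals.\<close>
  have "distr (PiM I M) (PiM A M) (\<lambda>x. \<lambda>i\<in>A. x i) = PiM A M"
    using distr_PiM_reindex[of I M "\<lambda>i. i" A] M A by auto
  also have "\<dots> = PiM A (\<lambda>i. distr (PiM I M) (M i) (\<lambda>x. x i))"
    by (intro PiM_cong refl) (simp add: comp)
  finally have indep: "P.indep_vars M (\<lambda>i x. x i) A"
    using A coord by (subst P.indep_vars_iff_distr_eq_PiM') auto
  have \<phi>M: "\<phi> \<in> borel_measurable (M i)" if "i \<in> A" for i
    using \<phi>(1) N[OF that] by simp
  interpret H: Hoeffding_ineq "PiM I M" A "\<lambda>i x. \<phi> (x i)" "\<lambda>_. - K" "\<lambda>_. K"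
    "\<Sum>i\<in>A. P.expectation (\<lambda>x. \<phi> (x i))"
  proof unfold_locales
    show "P.indep_vars (\<lambda>_. borel) (\<lambda>i x. \<phi> (x i)) A"
      by (rule P.indep_vars_compose2[OF indep \<phi>M])
  next
    fix i assume i: "i \<in> A"
    have "\<phi> (x i) \<in> {-K..K}" if "x \<in> space (PiM I M)" for x
      using \<phi>(2)[of "x i"] measurable_space[OF coord[OF i] that] N[OF i] by auto
    thus "AE x in PiM I M. \<phi> (x i) \<in> {-K..K}"
      by (intro AE_I2)
  qed (use A in auto)
  have "P.expectation (\<lambda>x. \<phi> (x i)) = (LINT y|N. \<phi> y)" if "i \<in> A" for i
    using integral_distr[OF coord[OF that] \<phi>M[OF that]] comp[OF that] N[OF that] by simp
  hence mean: "(\<Sum>i\<in>A. P.expectation (\<lambda>x. \<phi> (x i))) = real (card A) * (LINT y|N. \<phi> y)"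
    by simp
  have n: "card A > 0"
    using A by (simp add: card_gt_0_iff)
  have pos: "(\<Sum>i\<in>A. (K - - K)\<^sup>2) > 0"
    using n K by simp
  have eq: "-2 * (real (card A) * \<epsilon>)\<^sup>2 / (\<Sum>i\<in>A. (K - - K)\<^sup>2) = - (\<epsilon>\<^sup>2 / (2 * K\<^sup>2)) * real (card A)"
    using n K by (simp add: field_simps power2_eq_square)
  show ?thesis
    using H.Hoeffding_ineq_abs_ge[of "real (card A) * \<epsilon>", OF _ pos] \<epsilon> unfolding mean eq by simp
qed

section \<open>Quantile grid of a continuous distribution function\<close>

text \<open>Continuity yields quantiles at all levels \<open>i / K\<close> with
  \<open>0 < i < K\<close>, of mesh below \<open>\<eta>\<close>; away from the extreme levels every
  point has a grid point closely above and closely below. The order relations \<open>x < q\<close>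
  and \<open>q < x\<close> let counts at \<open>x\<close> be compared with counts at
  \<open>q\<close>.\<close>

lemma (in real_distribution) finite_cdf_grid:
  assumes cont: "continuous_on UNIV (cdf M)" and \<eta>: "\<eta> > 0"
  obtains S where "finite S"
    "\<And>x. cdf M x \<ge> 1 - \<eta> \<or> (\<exists>q\<in>S. x < q \<and> cdf M q \<le> cdf M x + \<eta>)"
    "\<And>x. cdf M x \<le> \<eta> \<or> (\<exists>q\<in>S. q < x \<and> cdf M x - \<eta> \<le> cdf M q)"
proof -
  let ?F = "cdf M"
  obtain K :: nat where K: "K > 0" "1 / real K < \<eta>"
    using \<eta> nat_approx_posE by (metis zero_less_Suc)
  have "\<exists>q. ?F q = v" if v: "0 < v" "v < 1" for v
  proof -
    obtain a where a: "?F a < v"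
      using order_tendstoD(2)[OF cdf_lim_at_bot v(1)] by (auto simp: eventually_at_bot_linorder)
    obtain b where b: "v < ?F b"
      using order_tendstoD(1)[OF cdf_lim_at_top_prob v(2)] by (auto simp: eventually_at_top_linorder)
    have "a \<le> b"
      using a b cdf_nondecreasing[of b a] by linarith
    thus ?thesis
      using IVT'[of ?F a v b] a b continuous_on_subset[OF cont] by auto
  qed
  then obtain q where q: "\<And>v. 0 < v \<Longrightarrow> v < 1 \<Longrightarrow> ?F (q v) = v"
    by metis
  have less: "x < y" if "?F x < ?F y" for x y
    using that cdf_nondecreasing[of y x] by linarith
  let ?S = "(\<lambda>i. q (real i / real K)) ` {0<..<K}"
  have Kinv: "1 < \<eta> * real K"
    using K by (simp add: field_simps)
  have qi: "?F (q (real i / real K)) = real i / real K" if "0 < i" "i < K" for i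
    using that by (intro q) auto
  show ?thesis
  proof (rule that[of ?S])
    fix x
    have F01: "0 \<le> ?F x" "?F x \<le> 1"
      by (rule cdf_nonneg, rule cdf_bounded_prob)
    have fl: "real (nat \<lfloor>real K * ?F x\<rfloor>) \<le> real K * ?F x"
      "real K * ?F x < real (nat \<lfloor>real K * ?F x\<rfloor>) + 1"
      using F01 K by (auto simp: of_nat_nat)
    \<comment> \<open>\<open>i / K\<close> is the lowest multiple of \<open>1 / K\<close> strictly
      above \<open>?F x\<close>; floor plus one keeps it strict also when \<open>?F x\<close> is
      itself such a multiple.\<close>
    define i where "i = Suc (nat \<lfloor>real K * ?F x\<rfloor>)"
    have "0 < i"
      by (simp add: i_def)
    show "?F x \<ge> 1 - \<eta> \<or> (\<exists>q\<in>?S. x < q \<and> ?F q \<le> ?F x + \<eta>)"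
    proof (cases "i < K")
      case True
      have "?F x < real i / real K" "real i / real K \<le> ?F x + \<eta>"
        using fl K Kinv by (auto simp: i_def field_simps)
      thus ?thesis
        using True qi[of i] less[of x "q (real i / real K)"] \<open>0 < i\<close>
        by (intro disjI2 bexI[of _ "q (real i / real K)"] imageI) auto
    next
      case False
      hence "real K * ?F x \<ge> real K - 1"
        using fl K by (auto simp: i_def)
      hence "real K * ?F x \<ge> real K * (1 - \<eta>)"
        using Kinv by (simp add: algebra_simps)
      thus ?thesis
        using K by simp
    qed
    have ce: "real K * ?F x \<le> real (nat \<lceil>real K * ?F x\<rceil>)" 
      "real (nat \<lceil>real K * ?F x\<rceil>) < real K * ?F x + 1"
      using F01 K ceiling_correct[of "real K * ?F x"] by (auto simp: of_nat_nat)
    \<comment> \<open>For \<open>j > 0\<close>, \<open>j / K\<close> is the highest level strictly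
      below \<open>?F x\<close>. Truncated subtraction makes \<open>j = 0\<close> cover the ceilings
      0 and 1, both of which mean \<open>?F x \<le> 1 / K\<close>.\<close>
    define j where "j = nat \<lceil>real K * ?F x\<rceil> - 1"
    show "?F x \<le> \<eta> \<or> (\<exists>q\<in>?S. q < x \<and> ?F x - \<eta> \<le> ?F q)"
    proof (cases "j > 0")
      case True
      hence "nat \<lceil>real K * ?F x\<rceil> = j + 1"
        unfolding j_def by linarith
      hence j: "real j = real (nat \<lceil>real K * ?F x\<rceil>) - 1"
        by (metis of_nat_1 of_nat_add add_diff_cancel_right')
      have "real j < real K * 1"
        using j ce F01 mult_left_mono[of "?F x" 1 "real K"] by linarith
      hence "j < K"
        by simp
      moreover have "real j < real K * ?F x" "real K * ?F x \<le> real j + \<eta> * real K"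
        using j ce Kinv by linarith+
      hence "real j / real K < ?F x" "?F x - \<eta> \<le> real j / real K"
        using K by (auto simp: field_simps)
      ultimately show ?thesis
        using True qi[of j] less[of "q (real j / real K)" x]
        by (intro disjI2 bexI[of _ "q (real j / real K)"]) auto
    next
      case False
      hence "nat \<lceil>real K * ?F x\<rceil> \<le> 1"
        by (simp add: j_def)
      hence "real K * ?F x \<le> real K * \<eta>"
        using ce Kinv by (simp add: algebra_simps)
      thus ?thesis
        using K by simp
    qed
  qed simp
qed

section \<open>Conformal p-values versus population ranks\<close>

text \<open>The randomizer only scales the tie count, so its extreme values 0 and 1 give the strict
  and the weak empirical rank.\<close>

lemma conformal_p_between:
  assumes "j \<ge> 1" "0 \<le> l j" "l j \<le> 1"
  shows "(\<Sum>i=1..j. of_bool (x i < x j)) / real j \<le> conformal_p (x, l) j"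
    and "conformal_p (x, l) j \<le> (\<Sum>i=1..j. of_bool (x i \<le> x j)) / real j"
proof -
  let ?t = "\<Sum>i=1..j. of_bool (x i = x j) :: real"
  have t: "0 \<le> ?t"
    by (intro sum_nonneg) auto
  have "(\<Sum>i=1..j. of_bool (x i \<le> x j)) = (\<Sum>i=1..j. of_bool (x i < x j)) + ?t"
    unfolding sum.distrib[symmetric] by (intro sum.cong) auto
  thus "(\<Sum>i=1..j. of_bool (x i < x j)) / real j \<le> conformal_p (x, l) j"
    and "conformal_p (x, l) j \<le> (\<Sum>i=1..j. of_bool (x i \<le> x j)) / real j"
    using assms t mult_right_mono[of "l j" 1 ?t] by (auto simp: conformal_p_def field_simps)
qed

lemma conformal_p_unit:
  assumes "j \<ge> 1" "0 \<le> l j" "l j \<le> 1"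
  shows "conformal_p (x, l) j \<in> {0..1}"
proof -
  have "(\<Sum>i=1..j. of_bool (x i \<le> x j) :: real) \<le> (\<Sum>i=1..j. 1)"
    by (intro sum_mono) auto
  hence "(\<Sum>i=1..j. of_bool (x i \<le> x j)) / real j \<le> 1"
    using assms by (simp add: field_simps)
  moreover have "0 \<le> (\<Sum>i=1..j. of_bool (x i < x j)) / real j"
    by (intro divide_nonneg_nonneg sum_nonneg) auto
  ultimately show ?thesis
    using conformal_p_between[of j l x, OF assms] unfolding atLeastAtMost_iff by linarith
qed

text \<open>A deterministic fact about one sample. The first \<open>T\<close> points determine the
  rank up to \<open>2 * \<eta>\<close>: one \<open>\<eta>\<close> for moving to a grid point, one
  for the empirical error there. The \<open>j - T\<close> later points, wherever they lie, shift the
  rank by at most \<open>(j - T) / T\<close>.\<close>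

lemma conformal_p_near:
  fixes F :: "real \<Rightarrow> real"
  assumes F: "0 \<le> F (x j)" "F (x j) \<le> 1" and \<eta>: "\<eta> > 0"
    and up: "F (x j) \<ge> 1 - \<eta> \<or> (\<exists>q\<in>S. x j < q \<and> F q \<le> F (x j) + \<eta>)"
    and down: "F (x j) \<le> \<eta> \<or> (\<exists>q\<in>S. q < x j \<and> F (x j) - \<eta> \<le> F q)"
    and emp: "\<And>q. q \<in> S \<Longrightarrow> \<bar>(\<Sum>i=1..T. of_bool (x i \<le> q)) - real T * F q\<bar> \<le> real T * \<eta>"
    and j: "1 \<le> T" "T < j" and l: "0 \<le> l j" "l j \<le> 1"
  shows "\<bar>conformal_p (x, l) j - F (x j)\<bar> \<le> 2 * \<eta> + (real j - real T) / real T"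
proof -
  have split: "(\<Sum>i=1..j. \<psi> i) = (\<Sum>i=1..T. \<psi> i) + (\<Sum>i=T+1..j. \<psi> i)" for \<psi> :: "nat \<Rightarrow> real"
    using j sum.ub_add_nat[of 1 T \<psi> "j - T"] by simp
  let ?p = "conformal_p (x, l) j"
  note p = conformal_p_between[of j l x] conformal_p_unit[of j l x]
  have "(\<Sum>i=1..T. of_bool (x i \<le> x j)) \<le> real T * (F (x j) + 2 * \<eta>)"
  \<comment> \<open>Near level 1 there may be no grid point above; there the trivial count
    \<open>T\<close> is within the tolerance.\<close>
  proof (cases "F (x j) \<ge> 1 - \<eta>")
    case True
    have "(\<Sum>i=1..T. of_bool (x i \<le> x j)) \<le> (\<Sum>i=1..T. 1 :: real)"
      by (intro sum_mono) auto
    also have "\<dots> \<le> real T * (F (x j) + 2 * \<eta>)"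
      using True \<eta> mult_left_mono[of 1 "F (x j) + 2 * \<eta>" "real T"] by simp
    finally show ?thesis .
  next
    case False
    with up obtain q where q: "q \<in> S" "x j < q" "F q \<le> F (x j) + \<eta>" by auto
    have "(\<Sum>i=1..T. of_bool (x i \<le> x j)) \<le> (\<Sum>i=1..T. of_bool (x i \<le> q) :: real)"
      using q by (intro sum_mono) auto
    also have "\<dots> \<le> real T * (F q + \<eta>)"
      using emp[OF q(1)] by (simp add: algebra_simps)
    also have "\<dots> \<le> real T * (F (x j) + 2 * \<eta>)"
      using q by (intro mult_left_mono) auto
    finally show ?thesis .
  qed
  moreover have "(\<Sum>i=T+1..j. of_bool (x i \<le> x j)) \<le> (\<Sum>i=T+1..j. 1 :: real)"
    by (intro sum_mono) auto
  ultimately have "(\<Sum>i=1..j. of_bool (x i \<le> x j)) \<le> real T * (F (x j) + 2 * \<eta>) + (real j - real T)"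
    using j unfolding split by (auto simp: of_nat_diff)
  hence "?p \<le> (real T * (F (x j) + 2 * \<eta>) + (real j - real T)) / real j"
    using j l by (intro order_trans[OF p(2) divide_right_mono]) auto
  also have "\<dots> = real T / real j * (F (x j) + 2 * \<eta>) + (real j - real T) / real j"
    by (simp add: add_divide_distrib)
  also have "\<dots> \<le> 1 * (F (x j) + 2 * \<eta>) + (real j - real T) / real T"
    using j F \<eta> by (intro add_mono mult_right_mono divide_left_mono) auto
  finally have upper: "?p \<le> F (x j) + 2 * \<eta> + (real j - real T) / real T"
    by simp
  have "F (x j) - 2 * \<eta> - (real j - real T) / real T \<le> ?p"
  \<comment> \<open>In the first case the lower bound is at most 0 and nonnegativity of the p-value
    is enough. The threshold is \<open>2 * \<eta>\<close>, not \<open>\<eta>\<close>, so that the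
    factor \<open>F (x j) - 2 * \<eta>\<close> is positive in the other case.\<close>
  proof (cases "F (x j) \<le> 2 * \<eta>")
    case True
    moreover have "0 \<le> (real j - real T) / real T"
      using j by simp
    ultimately show ?thesis
      using p(3) j l unfolding atLeastAtMost_iff by linarith
  next
    case False
    with down \<eta> obtain q where q: "q \<in> S" "q < x j" "F (x j) - \<eta> \<le> F q" by auto
    have "real T * (F (x j) - 2 * \<eta>) \<le> real T * (F q - \<eta>)"
      using q by (intro mult_left_mono) auto
    also have "\<dots> \<le> (\<Sum>i=1..T. of_bool (x i \<le> q))"
      using emp[OF q(1)] by (simp add: algebra_simps)
    also have "\<dots> \<le> (\<Sum>i=1..T. of_bool (x i < x j))"
      using q by (intro sum_mono) auto
    also have "\<dots> \<le> (\<Sum>i=1..j. of_bool (x i < x j))"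
      unfolding split by (simp add: sum_nonneg)
    finally have low: "real T * (F (x j) - 2 * \<eta>) / real j \<le> ?p"
      using j l by (intro order_trans[OF divide_right_mono p(1)]) auto
    \<comment> \<open>Dividing the pre-change count by \<open>j\<close> instead of \<open>T\<close>
      costs this share, at most \<open>(j - T) / T\<close>.\<close>
    have "F (x j) - 2 * \<eta> - real T * (F (x j) - 2 * \<eta>) / real j
        = (real j - real T) / real j * (F (x j) - 2 * \<eta>)"
      using j by (simp add: field_simps)
    also have "\<dots> \<le> (real j - real T) / real T * 1"
      using j F \<eta> False by (intro mult_mono divide_left_mono) auto
    finally show ?thesis
      using low by simp
  qed
  thus ?thesis
    using upper by linarith
qed

section \<open>Law of the post-change ranks\<close>

text \<open>\<open>rank_cdf P0 P1\<close> is the distribution function of \<open>cdf P0 Y\<close>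
  with \<open>Y\<close> drawn from \<open>P1\<close>, and a distribution function determines its
  law.\<close>

lemma interval_measure_rank_cdf:
  assumes "real_distribution P0" "real_distribution P1" and cont: "continuous_on UNIV (cdf P0)"
  shows "interval_measure (rank_cdf P0 P1) = distr P1 borel (cdf P0)"
proof -
  interpret P1: real_distribution P1 by fact
  have F: "cdf P0 \<in> borel_measurable P1"
    using cont by (intro P1.measurable_finite_borel borel_measurable_continuous_onI)
  interpret D: real_distribution "distr P1 borel (cdf P0)"
    using F by (intro real_distribution.intro real_distribution_axioms.intro P1.prob_space_distr) auto
  have "rank_cdf P0 P1 = cdf (distr P1 borel (cdf P0))"
    using F by (auto simp: fun_eq_iff rank_cdf_def cdf_def measure_distr vimage_def Int_def conj_commute)
  moreover have "real_distribution (interval_measure (cdf (distr P1 borel (cdf P0))))"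
    by (intro real_distribution_interval_measure D.cdf_nondecreasing
        D.cdf_is_right_cont D.cdf_lim_at_bot D.cdf_lim_at_top_prob)
  moreover have "cdf (interval_measure (cdf (distr P1 borel (cdf P0)))) = cdf (distr P1 borel (cdf P0))"
    by (rule cdf_interval_measure)
       (rule D.cdf_nondecreasing D.cdf_is_right_cont D.cdf_lim_at_bot, assumption?)+
  ultimately show ?thesis
    using D.real_distribution_axioms by (metis cdf_unique)
qed

text \<open>Change of variables that makes \<open>J\<close> the mean of \<open>g (cdf P0 Y)\<close>,
  the form used in Hoeffding's inequality. The restriction to \<open>{0..1}\<close> disappears
  because \<open>cdf P0\<close> takes its values there.\<close>

lemma set_lebesgue_integral_rank_cdf:
  fixes g :: "real \<Rightarrow> real"
  assumes "real_distribution P0" "real_distribution P1" and cont: "continuous_on UNIV (cdf P0)"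
    and g: "continuous_on {0..1} g"
  shows "(LINT u:{0..1}|interval_measure (rank_cdf P0 P1). g u) = (LINT y|P1. g (cdf P0 y))"
proof -
  interpret P0: real_distribution P0 by fact
  interpret P1: real_distribution P1 by fact
  have F: "cdf P0 \<in> borel_measurable P1"
    using cont by (intro P1.measurable_finite_borel borel_measurable_continuous_onI)
  have "(\<lambda>u. indicator {0..1} u *\<^sub>R g u) \<in> borel_measurable borel"
    using g by (intro borel_measurable_continuous_on_indicator) auto
  thus ?thesis
    unfolding interval_measure_rank_cdf[OF assms(1-3)] set_lebesgue_integral_def
    by (subst integral_distr[OF F]) (auto simp: P0.cdf_nonneg P0.cdf_bounded_prob)
qed

section \<open>Mixture bounds, stopping times and the row law\<close>

lemma mixture_ge:
  assumes "finite_measure Q" and A: "A \<in> sets Q" and "0 \<le> c"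
    and c: "\<And>a. a \<in> A \<Longrightarrow> c \<le> (\<Prod>j=k..t. f a (conformal_p \<omega> j))"
  shows "ennreal (c * measure Q A) \<le> mixture Q f \<omega> k t"
proof -
  interpret finite_measure Q by fact
  have "ennreal (c * measure Q A) = (\<integral>\<^sup>+a. ennreal c * indicator A a \<partial>Q)"
    using A \<open>0 \<le> c\<close> by (simp add: nn_integral_cmult_indicator emeasure_eq_measure ennreal_mult)
  also have "\<dots> \<le> mixture Q f \<omega> k t"
    unfolding mixture_def
    by (intro nn_integral_mono) (auto simp: indicator_def intro!: ennreal_leI c)
  finally show ?thesis .
qed

text \<open>Not having stopped by \<open>t\<close> puts the statistic at time \<open>t\<close> below
  \<open>b\<close>, and a summand never exceeds a nonnegative sum. The conclusion has the same form
  for sum and maximum, so one argument serves both detectors.\<close>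

lemma tau_S_gt:
  assumes "tau_S Q f w b \<omega> > enat t" "1 \<le> k" "k \<le> t"
  shows "ennreal (w k) * mixture Q f \<omega> k t < ennreal b"
proof -
  have "\<not> ennreal b \<le> stat_S Q f w \<omega> t"
    using assms Inf_lower[of "enat t" "{enat t | t. 1 \<le> t \<and> ennreal b \<le> stat_S Q f w \<omega> t}"]
    by (auto simp: tau_S_def)
  moreover have "ennreal (w k) * mixture Q f \<omega> k t \<le> stat_S Q f w \<omega> t"
    unfolding stat_S_def using assms by (intro member_le_sum) auto
  ultimately show ?thesis by simp
qed

lemma tau_Z_gt:
  assumes "tau_Z Q f w b \<omega> > enat t" "1 \<le> k" "k \<le> t"
  shows "ennreal (w k) * mixture Q f \<omega> k t < ennreal b"
proof -
  have "\<not> ennreal b \<le> stat_Z Q f w \<omega> t"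
    using assms Inf_lower[of "enat t" "{enat t | t. 1 \<le> t \<and> ennreal b \<le> stat_Z Q f w \<omega> t}"]
    by (auto simp: tau_Z_def)
  moreover have "ennreal (w k) * mixture Q f \<omega> k t \<le> stat_Z Q f w \<omega> t"
    unfolding stat_Z_def using assms by (intro Max_ge) auto
  ultimately show ?thesis by simp
qed

text \<open>The event on the left need not be measurable: its measure is then the junk value 0.\<close>

lemma measure_row_law_le:
  assumes P: "prob_space P0" "prob_space P1"
    and E: "E \<in> sets (PiM {1..} (\<lambda>j. if j \<le> T then P0 else P1))"
    and R: "\<And>x l. x \<in> space (PiM {1..} (\<lambda>j. if j \<le> T then P0 else P1)) \<Longrightarrow>
      (\<And>j. j \<ge> 1 \<Longrightarrow> 0 \<le> l j \<and> l j \<le> 1) \<Longrightarrow> R (x, l) \<Longrightarrow> x \<in> E"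
  shows "\<P>(\<omega> in row_law P0 T P1. R \<omega>)
    \<le> measure (PiM {1..} (\<lambda>j. if j \<le> T then P0 else P1)) E"
proof -
  let ?X = "PiM {1::nat..} (\<lambda>j. if j \<le> T then P0 else P1)"
  let ?U = "uniform_measure lborel {0<..<1::real}"
  let ?L = "PiM {1::nat..} (\<lambda>_. ?U)"
  have U: "prob_space ?U"
    by (rule prob_space_uniform_measure) auto
  interpret X: prob_space ?X
    using P by (intro prob_space_PiM) auto
  interpret L: prob_space ?L
    using U by (intro prob_space_PiM) auto
  interpret XL: pair_prob_space ?X ?L ..
  \<comment> \<open>The inclusion of events needs all randomizers in \<open>[0,1]\<close>; being
    countably many, they satisfy this simultaneously almost surely.\<close>
  have "AE u in ?U. 0 \<le> u \<and> u \<le> 1"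
    by (intro AE_uniform_measureI) auto
  hence "AE l in ?L. 0 \<le> l j \<and> l j \<le> 1" if "j \<in> {1..}" for j
    using U that by (intro AE_PiM_component[where P = "\<lambda>u. 0 \<le> u \<and> u \<le> 1"]) auto
  hence "AE l in ?L. \<forall>j\<in>{1..}. 0 \<le> l j \<and> l j \<le> 1"
    by (subst AE_ball_countable) auto
  hence "AE \<omega> in ?X \<Otimes>\<^sub>M ?L. \<forall>j\<in>{1..}. 0 \<le> snd \<omega> j \<and> snd \<omega> j \<le> 1"
    by (intro XL.AE_pair_measure) auto
  hence "AE \<omega> in row_law P0 T P1. \<omega> \<in> {\<omega> \<in> space (row_law P0 T P1). R \<omega>}
      \<longrightarrow> \<omega> \<in> fst -` E \<inter> space (row_law P0 T P1)"
    unfolding row_law_def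
  proof (rule AE_mp, intro AE_I2 impI)
    fix \<omega> assume "\<omega> \<in> space (?X \<Otimes>\<^sub>M ?L)" "\<forall>j\<in>{1..}. 0 \<le> snd \<omega> j \<and> snd \<omega> j \<le> 1"
      "\<omega> \<in> {\<omega> \<in> space (?X \<Otimes>\<^sub>M ?L). R \<omega>}"
    thus "\<omega> \<in> fst -` E \<inter> space (?X \<Otimes>\<^sub>M ?L)"
      using R[of "fst \<omega>" "snd \<omega>"] by (auto simp: space_pair_measure)
  qed
  moreover have fE: "fst -` E \<inter> space (row_law P0 T P1) \<in> sets (row_law P0 T P1)"
    unfolding row_law_def using E by (intro measurable_sets[OF measurable_fst])
  ultimately have "\<P>(\<omega> in row_law P0 T P1. R \<omega>) \<le> measure (row_law P0 T P1) (fst -` E \<inter> space (row_law P0 T P1))"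
    by (intro finite_measure.finite_measure_mono_AE) (auto simp: row_law_def XL.finite_measure_axioms simp del: One_nat_def)
  \<comment> \<open>The bounding event ignores the randomizers, so projecting them away leaves its
    probability under the data alone.\<close>
  also have "\<dots> = measure (distr (row_law P0 T P1) ?X fst) E"
    using E by (subst measure_distr) (auto simp: row_law_def)
  also have "distr (row_law P0 T P1) ?X fst = ?X"
    unfolding row_law_def by (rule L.distr_pair_fst)
  finally show ?thesis .
qed

section \<open>Local likelihood bounds along the parametrized densities\<close>

text \<open>Mean value inequality on the convex set \<open>{-\<theta>0..\<theta>0}\<close>;
  derivatives within it are one-sided at the end points.\<close>

lemma ln_lipschitz_of_score_bound:
  fixes h :: "real \<Rightarrow> real \<Rightarrow> real"
  assumes score: "\<And>\<theta>. \<bar>\<theta>\<bar> \<le> \<theta>0 \<Longrightarrow>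
      \<exists>D. ((\<lambda>\<theta>'. ln (h \<theta>' u)) has_real_derivative D) (at \<theta> within {-\<theta>0..\<theta>0}) \<and> \<bar>D\<bar> \<le> B"
    and "\<bar>\<theta>\<bar> \<le> \<theta>0" "\<bar>\<theta>'\<bar> \<le> \<theta>0"
  shows "\<bar>ln (h \<theta>' u) - ln (h \<theta> u)\<bar> \<le> B * \<bar>\<theta>' - \<theta>\<bar>"
proof -
  obtain D where "\<And>\<theta>. \<bar>\<theta>\<bar> \<le> \<theta>0 \<Longrightarrow>
      ((\<lambda>\<theta>'. ln (h \<theta>' u)) has_real_derivative D \<theta>) (at \<theta> within {-\<theta>0..\<theta>0}) \<and> \<bar>D \<theta>\<bar> \<le> B"
    using score by metis
  thus ?thesis
    using field_differentiable_bound[of "{-\<theta>0..\<theta>0}" "\<lambda>\<theta>'. ln (h \<theta>' u)" D B \<theta>' \<theta>] assms(2,3)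
    by (auto simp: abs_le_iff)
qed

text \<open>Each factor loses at most \<open>C * \<theta>\<^sup>2\<close> in the exponent by
  linearizing the log-density at \<open>\<theta>\<close>, and \<open>B * \<epsilon>\<close> by
  moving from \<open>\<theta>\<close> to a nearby \<open>\<theta>'\<close>; the nearby parameters
  carry mass at least \<open>m\<close>.\<close>

lemma mixture_ge_exp:
  fixes h :: "real \<Rightarrow> real \<Rightarrow> real"
  assumes Q: "finite_measure Q" and \<theta>: "\<bar>\<theta>\<bar> \<le> \<theta>0"
    and h_pos: "\<And>\<theta> u. \<bar>\<theta>\<bar> \<le> \<theta>0 \<Longrightarrow> u \<in> {0..1} \<Longrightarrow> h \<theta> u > 0"
    and expansion: "\<And>u. u \<in> {0..1} \<Longrightarrow> \<bar>ln (h \<theta> u) - \<theta> * g u\<bar> \<le> C * \<theta>\<^sup>2"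
    and score: "\<And>\<theta> u. \<bar>\<theta>\<bar> \<le> \<theta>0 \<Longrightarrow> u \<in> {0..1} \<Longrightarrow>
      \<exists>D. ((\<lambda>\<theta>'. ln (h \<theta>' u)) has_real_derivative D) (at \<theta> within {-\<theta>0..\<theta>0}) \<and> \<bar>D\<bar> \<le> B"
    and B: "B \<ge> 0"
    and mass: "m \<le> family_mass Q f {h \<theta>' | \<theta>'. \<bar>\<theta>'\<bar> \<le> \<theta>0 \<and> \<bar>\<theta>' - \<theta>\<bar> \<le> \<epsilon>}" "m > 0"
    and unit: "\<And>j. j \<in> {k..t} \<Longrightarrow> conformal_p \<omega> j \<in> {0..1}"
  shows "ennreal (exp (\<theta> * (\<Sum>j=k..t. g (conformal_p \<omega> j))
      - real (card {k..t}) * (C * \<theta>\<^sup>2 + B * \<epsilon>)) * m) \<le> mixture Q f \<omega> k t"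
proof -
  let ?G = "{h \<theta>' | \<theta>'. \<bar>\<theta>'\<bar> \<le> \<theta>0 \<and> \<bar>\<theta>' - \<theta>\<bar> \<le> \<epsilon>}"
  let ?A = "{a \<in> space Q. \<exists>h\<in>?G. \<forall>u\<in>{0..1}. f a u = h u}"
  let ?c = "exp (\<theta> * (\<Sum>j=k..t. g (conformal_p \<omega> j)) - real (card {k..t}) * (C * \<theta>\<^sup>2 + B * \<epsilon>))"
  have A: "m \<le> measure Q ?A"
    using mass(1) unfolding family_mass_def .
  \<comment> \<open>A non-measurable set has measure 0 by default, so \<open>m > 0\<close> forces
    measurability.\<close>
  have "?A \<in> sets Q"
    using A mass(2) measure_notin_sets[of ?A Q] by argo
  moreover have "?c \<le> (\<Prod>j=k..t. f a (conformal_p \<omega> j))" if a: "a \<in> ?A" for a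
  proof -
    obtain \<theta>' where \<theta>': "\<bar>\<theta>'\<bar> \<le> \<theta>0" "\<bar>\<theta>' - \<theta>\<bar> \<le> \<epsilon>" and f: "\<And>u. u \<in> {0..1} \<Longrightarrow> f a u = h \<theta>' u"
      using a by blast
    have ln: "\<theta> * g u - (C * \<theta>\<^sup>2 + B * \<epsilon>) \<le> ln (h \<theta>' u)" if u: "u \<in> {0..1}" for u
    proof -
      have "\<bar>ln (h \<theta>' u) - ln (h \<theta> u)\<bar> \<le> B * \<bar>\<theta>' - \<theta>\<bar>"
        using ln_lipschitz_of_score_bound[of \<theta>0 h u B \<theta> \<theta>'] score[OF _ u] \<theta> \<theta>' by blast
      moreover have "B * \<bar>\<theta>' - \<theta>\<bar> \<le> B * \<epsilon>"
        using B \<theta>' by (intro mult_left_mono)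
      ultimately show ?thesis
        using expansion[OF u] by linarith
    qed
    have "?c = (\<Prod>j=k..t. exp (\<theta> * g (conformal_p \<omega> j) - (C * \<theta>\<^sup>2 + B * \<epsilon>)))"
      by (simp add: exp_sum[symmetric] sum_subtractf sum_distrib_left)
    also have "\<dots> \<le> (\<Prod>j=k..t. f a (conformal_p \<omega> j))"
    proof (intro prod_mono conjI)
      fix j assume "j \<in> {k..t}"
      note u = unit[OF this]
      show "exp (\<theta> * g (conformal_p \<omega> j) - (C * \<theta>\<^sup>2 + B * \<epsilon>)) \<le> f a (conformal_p \<omega> j)"
        using ln[OF u] f[OF u] h_pos[OF \<theta>'(1) u] by (simp add: ln_ge_iff)
    qed simp
    finally show ?thesis .
  qed
  ultimately have "ennreal (?c * measure Q ?A) \<le> mixture Q f \<omega> k t"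
    by (intro mixture_ge[OF Q]) auto
  moreover have "ennreal (?c * m) \<le> ennreal (?c * measure Q ?A)"
    using A by (intro ennreal_leI mult_left_mono) auto
  ultimately show ?thesis
    by (rule order_trans[rotated])
qed

theorem theorem4p1:
  fixes P0 P1 :: "real measure"
    and Q :: "'a measure" and f :: "'a \<Rightarrow> real \<Rightarrow> real"
    and \<theta>0 C B c\<^sub>Q J \<gamma>0 I\<^sub>R :: real
    and g :: "real \<Rightarrow> real" and h :: "real \<Rightarrow> real \<Rightarrow> real"
  assumes P0: "prob_space P0" "sets P0 = sets borel"
    and P1: "prob_space P1" "sets P1 = sets borel"
    and family: "betting_family Q f"
    and cont_F: "continuous_on UNIV (cdf P0)"
    and cont_H: "continuous_on {0..1} (rank_cdf P0 P1)"
    and H0: "rank_cdf P0 P1 0 = 0"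
    and separation: "(SUP t\<in>{0..1}. \<bar>rank_cdf P0 P1 t - t\<bar>) > 0"
    and constants_pos: "\<theta>0 > 0" "c\<^sub>Q > 0"
    and g_bounded: "bounded (g ` {0..1})"
    and g_lipschitz: "\<exists>L. L-lipschitz_on {0..1} g"
    and h_in_family: "\<And>\<theta>. \<bar>\<theta>\<bar> \<le> \<theta>0 \<Longrightarrow> \<exists>a\<in>space Q. \<forall>u\<in>{0..1}. f a u = h \<theta> u"
    and h_zero: "\<And>u. u \<in> {0..1} \<Longrightarrow> h 0 u = 1"
    and g_mean: "(LBINT u:{0..1}. g u) = 0"
    and J_def: "J = (LINT u:{0..1}|interval_measure (rank_cdf P0 P1). g u)"
    and J_nonzero: "J \<noteq> 0"
    and h_pos: "\<And>\<theta> u. \<bar>\<theta>\<bar> \<le> \<theta>0 \<Longrightarrow> u \<in> {0..1} \<Longrightarrow> h \<theta> u > 0"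
    and h_expansion: "\<And>\<theta> u. \<bar>\<theta>\<bar> \<le> \<theta>0 \<Longrightarrow> u \<in> {0..1} \<Longrightarrow> \<bar>ln (h \<theta> u) - \<theta> * g u\<bar> \<le> C * \<theta>\<^sup>2"
    and h_score: "\<And>\<theta> u. \<bar>\<theta>\<bar> \<le> \<theta>0 \<Longrightarrow> u \<in> {0..1} \<Longrightarrow>
      \<exists>D. ((\<lambda>\<theta>'. ln (h \<theta>' u)) has_real_derivative D) (at \<theta> within {-\<theta>0..\<theta>0}) \<and> \<bar>D\<bar> \<le> B"
    and mass: "\<forall>\<^sub>F \<epsilon> in at_right 0. \<forall>\<theta>\<in>{-\<theta>0/2..\<theta>0/2}.
      family_mass Q f {h \<theta>' | \<theta>'. \<bar>\<theta>'\<bar> \<le> \<theta>0 \<and> \<bar>\<theta>' - \<theta>\<bar> \<le> \<epsilon>} \<ge> c\<^sub>Q * \<epsilon>"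
    and \<gamma>0: "0 < \<gamma>0" "\<gamma>0 < \<theta>0 / 2"
    and I\<^sub>R_def: "I\<^sub>R = info_rate J C \<gamma>0"
    and I\<^sub>R_pos: "I\<^sub>R > 0"
  shows "\<exists>c0 c1 c2 \<delta>0 :: real. c0 > 0 \<and> c1 > 0 \<and> c2 > 0 \<and> 0 < \<delta>0 \<and> \<delta>0 < 1 \<and>
    (\<forall>(T :: nat \<Rightarrow> nat) (w :: nat \<Rightarrow> real) (b :: nat \<Rightarrow> real).
       (\<forall>n\<ge>1. T n \<ge> 1) \<longrightarrow> mono_on {1..} T \<longrightarrow> filterlim T at_top sequentially \<longrightarrow>
       (\<forall>k\<ge>1. w k \<ge> 0) \<longrightarrow> (\<forall>n\<ge>1. b n > 0) \<longrightarrow>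
       (\<forall>\<^sub>F n in sequentially. \<forall>r::nat.
          1 \<le> r \<longrightarrow> real r \<le> \<delta>0 * real (T n) \<longrightarrow>
          ereal (I\<^sub>R / 2 * real r - ln (real r) - c0) \<ge> log_barrier w (T n) (b n) \<longrightarrow>
          \<P>(\<omega> in row_law P0 (T n) P1. tau_S Q f w (b n) \<omega> > enat (T n + r)) \<le> c1 * exp (- c2 * real r) \<and>
          \<P>(\<omega> in row_law P0 (T n) P1. tau_Z Q f w (b n) \<omega> > enat (T n + r)) \<le> c1 * exp (- c2 * real r)))"
proof -

  \<comment> \<open>Constants of the delay bound\<close>
  interpret P0: real_distribution P0
    using P0 by (intro real_distribution.intro real_distribution_axioms.intro)
  interpret P1: real_distribution P1
    using P1 by (intro real_distribution.intro real_distribution_axioms.intro)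
  let ?F = "cdf P0"
  have F01: "?F y \<in> {0..1}" for y
    by (simp add: P0.cdf_nonneg P0.cdf_bounded_prob)
  obtain L where L: "L-lipschitz_on {0..1} g"
    using g_lipschitz by blast
  note L0 = lipschitz_on_nonneg[OF L]
  note g_cont = lipschitz_on_continuous_on[OF L]
  obtain K where K: "K > 0" "\<And>u. u \<in> {0..1} \<Longrightarrow> \<bar>g u\<bar> \<le> K"
    using g_bounded unfolding bounded_pos by auto
  have B0: "B \<ge> 0"
    using h_score[of 0 0] constants_pos by force
  have Q: "finite_measure Q"
    using family by (simp add: betting_family_def prob_space.finite_measure)
  obtain \<kappa>0 where \<kappa>0: "\<kappa>0 > 0" and mass': "\<And>\<epsilon> \<theta>. 0 < \<epsilon> \<Longrightarrow> \<epsilon> < \<kappa>0 \<Longrightarrow> \<theta> \<in> {-\<theta>0/2..\<theta>0/2} \<Longrightarrow>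
      c\<^sub>Q * \<epsilon> \<le> family_mass Q f {h \<theta>' | \<theta>'. \<bar>\<theta>'\<bar> \<le> \<theta>0 \<and> \<bar>\<theta>' - \<theta>\<bar> \<le> \<epsilon>}"
    using mass unfolding eventually_at_right_field by blast
  \<comment> \<open>Half of \<open>\<kappa>0\<close> keeps every radius \<open>\<kappa> / r\<close>
    with \<open>r \<ge> 1\<close> strictly below \<open>\<kappa>0\<close>.\<close>
  define \<kappa> where "\<kappa> = \<kappa>0 / 2"
  \<comment> \<open>The sign makes the drift \<open>\<theta> * J\<close> positive.\<close>
  define \<theta> where "\<theta> = sgn J * \<gamma>0"
  have \<theta>: "\<bar>\<theta>\<bar> = \<gamma>0" "\<theta>\<^sup>2 = \<gamma>0\<^sup>2" "\<theta> * J = \<gamma>0 * \<bar>J\<bar>"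
    using J_nonzero \<gamma>0 by (auto simp: \<theta>_def abs_mult abs_sgn_eq sgn_if)
  \<comment> \<open>Error budget: sampling fluctuation and rank approximation cost
    \<open>\<epsilon>\<close> each per observation, in total
    \<open>2 * \<gamma>0 * \<epsilon> = I\<^sub>R / 2\<close>. The next two choices give
    \<open>2 * \<eta> + \<delta>0 \<le> \<epsilon> / (L + 1)\<close>, which the Lipschitz bound
    turns into at most \<open>\<epsilon>\<close>; \<open>L + 1\<close> avoids division by
    zero.\<close>
  define \<epsilon> where "\<epsilon> = I\<^sub>R / (4 * \<gamma>0)"
  define \<eta> where "\<eta> = \<epsilon> / (4 * (L + 1))"
  define \<delta>0 where "\<delta>0 = min (1/2) (\<epsilon> / (2 * (L + 1)))"
  have pos: "\<kappa> > 0" "\<epsilon> > 0" "\<eta> > 0" "0 < \<delta>0" "\<delta>0 < 1"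
    using \<kappa>0 I\<^sub>R_pos \<gamma>0 L0 by (auto simp: \<kappa>_def \<epsilon>_def \<eta>_def \<delta>0_def)
  obtain S where S: "finite S"
    "\<And>x. ?F x \<ge> 1 - \<eta> \<or> (\<exists>q\<in>S. x < q \<and> ?F q \<le> ?F x + \<eta>)"
    "\<And>x. ?F x \<le> \<eta> \<or> (\<exists>q\<in>S. q < x \<and> ?F x - \<eta> \<le> ?F q)"
    using P0.finite_cdf_grid[OF cont_F pos(3)] by metis
  \<comment> \<open>\<open>c0\<close> pays for the parameter shift and the mass constant, with
    \<open>max 1\<close> for positivity. \<open>c1\<close> collects a two-sided tail per grid point
    and one for the post-change sum; \<open>c2\<close> is the smaller of the two Hoeffding
    rates.\<close>
  define c0 where "c0 = max 1 (B * \<kappa> - ln (c\<^sub>Q * \<kappa>))"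
  define c1 where "c1 = 2 * real (card S) + 2"
  define c2 where "c2 = min (\<eta>\<^sup>2 / 2) (\<epsilon>\<^sup>2 / (2 * K\<^sup>2))"
  have c2: "c2 > 0"
    using pos K by (simp add: c2_def)
  define \<phi> where "\<phi> = (\<lambda>y. g (?F y))"
  have \<phi>_cont: "continuous_on UNIV \<phi>"
    unfolding \<phi>_def using F01 by (intro continuous_on_compose2[OF g_cont cont_F]) auto
  have mean_\<phi>: "(LINT y|P1. \<phi> y) = J"
    unfolding \<phi>_def J_def
    by (rule set_lebesgue_integral_rank_cdf[symmetric, OF P0.real_distribution_axioms P1.real_distribution_axioms cont_F g_cont])

  \<comment> \<open>Deterministic detection on the good event\<close>
  have detect: "ennreal b \<le> ennreal (w (T + 1)) * mixture Q f (x, l) (T + 1) (T + r)"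
    if T: "1 \<le> T" and r: "1 \<le> r" "real r \<le> \<delta>0 * real T"
      and l: "\<And>j. j \<ge> 1 \<Longrightarrow> 0 \<le> l j \<and> l j \<le> 1"
      and emp: "\<And>q. q \<in> S \<Longrightarrow> \<bar>(\<Sum>i=1..T. of_bool (x i \<le> q)) - real T * ?F q\<bar> \<le> real T * \<eta>"
      and post: "\<bar>(\<Sum>j=T+1..T+r. \<phi> (x j)) - real r * J\<bar> \<le> real r * \<epsilon>"
      and w: "w (T + 1) \<ge> 0" and b: "b > 0"
      and barrier: "log_barrier w T b \<le> ereal (I\<^sub>R / 2 * real r - ln (real r) - c0)"
    for T r :: nat and b :: real and w and x l :: "nat \<Rightarrow> real"
  proof -
    let ?p = "conformal_p (x, l)"
    have p01: "?p j \<in> {0..1}" if "j \<in> {T+1..T+r}" for j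
      using conformal_p_unit[of j l x] l[of j] that by auto
    have near: "\<bar>g (?p j) - \<phi> (x j)\<bar> \<le> \<epsilon>" if j: "j \<in> {T+1..T+r}" for j
    proof -
      have "\<bar>?p j - ?F (x j)\<bar> \<le> 2 * \<eta> + (real j - real T) / real T"
        using j T l[of j] F01[of "x j"] S(2,3)[of "x j"] emp pos
        by (intro conformal_p_near[where S = S]) auto
      also have "(real j - real T) / real T \<le> \<delta>0"
        using j T r by (simp add: field_simps)
      also have "2 * \<eta> + \<delta>0 \<le> \<epsilon> / (L + 1) / 2 + \<epsilon> / (L + 1) / 2"
        using L0 by (intro add_mono) (auto simp: \<eta>_def \<delta>0_def field_simps)
      also have "\<dots> = \<epsilon> / (L + 1)"
        by (rule field_sum_of_halves)
      finally have "\<bar>?p j - ?F (x j)\<bar> \<le> \<epsilon> / (L + 1)"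
        by simp
      hence "L * \<bar>?p j - ?F (x j)\<bar> \<le> (L + 1) * (\<epsilon> / (L + 1))"
        using L0 by (intro mult_mono) auto
      thus ?thesis
        using lipschitz_onD[OF L p01[OF j] F01[of "x j"]] L0 by (simp add: dist_real_def \<phi>_def)
    qed
    have "\<bar>(\<Sum>j=T+1..T+r. g (?p j)) - (\<Sum>j=T+1..T+r. \<phi> (x j))\<bar> \<le> (\<Sum>j=T+1..T+r. \<epsilon>)"
      unfolding sum_subtractf[symmetric] using near
      by (intro order_trans[OF sum_abs] sum_mono) auto
    with post have "\<bar>(\<Sum>j=T+1..T+r. g (?p j)) - real r * J\<bar> \<le> 2 * (real r * \<epsilon>)"
      by simp
    hence "\<gamma>0 * \<bar>(\<Sum>j=T+1..T+r. g (?p j)) - real r * J\<bar> \<le> \<gamma>0 * (2 * (real r * \<epsilon>))"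
      using \<gamma>0 by (intro mult_left_mono) auto
    moreover have "\<gamma>0 * (2 * (real r * \<epsilon>)) = real r * I\<^sub>R / 2"
      using \<gamma>0 by (simp add: \<epsilon>_def)
    moreover have "\<gamma>0 * \<bar>(\<Sum>j=T+1..T+r. g (?p j)) - real r * J\<bar>
        = \<bar>\<theta> * (\<Sum>j=T+1..T+r. g (?p j)) - real r * (\<gamma>0 * \<bar>J\<bar>)\<bar>"
      unfolding \<theta>(3)[symmetric] unfolding \<theta>(1)[symmetric] abs_mult[symmetric] by (simp add: algebra_simps)
    ultimately have drift: "real r * (\<gamma>0 * \<bar>J\<bar>) - real r * I\<^sub>R / 2 \<le> \<theta> * (\<Sum>j=T+1..T+r. g (?p j))"
      by linarith
    have "c\<^sub>Q * (\<kappa> / real r)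
        \<le> family_mass Q f {h \<theta>' | \<theta>'. \<bar>\<theta>'\<bar> \<le> \<theta>0 \<and> \<bar>\<theta>' - \<theta>\<bar> \<le> \<kappa> / real r}"
    proof (rule mass')
      have "\<kappa> / real r \<le> \<kappa> / 1"
        using r pos by (intro divide_left_mono) auto
      thus "\<kappa> / real r < \<kappa>0"
        using \<kappa>0 by (simp add: \<kappa>_def)
    qed (use r pos \<theta> \<gamma>0 in auto)
    hence "ennreal (exp (\<theta> * (\<Sum>j=T+1..T+r. g (?p j))
        - real (card {T+1..T+r}) * (C * \<theta>\<^sup>2 + B * (\<kappa> / real r))) * (c\<^sub>Q * (\<kappa> / real r)))
        \<le> mixture Q f (x, l) (T + 1) (T + r)"
      using h_pos h_expansion h_score Q B0 \<theta> \<gamma>0 constants_pos pos r p01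
      by (intro mixture_ge_exp) auto
    \<comment> \<open>Drift minus the \<open>C * \<gamma>0\<^sup>2\<close> terms is
      \<open>r * I\<^sub>R\<close>, half of which absorbs the errors. The \<open>r\<close> shifts of
      radius \<open>\<kappa> / r\<close> add up to \<open>B * \<kappa>\<close>, independently of
      \<open>r\<close>.\<close>
    moreover have "exp (I\<^sub>R / 2 * real r - B * \<kappa>) \<le> exp (\<theta> * (\<Sum>j=T+1..T+r. g (?p j))
        - real (card {T+1..T+r}) * (C * \<theta>\<^sup>2 + B * (\<kappa> / real r)))"
    proof -
      have "real (card {T+1..T+r}) * (C * \<theta>\<^sup>2 + B * (\<kappa> / real r)) = real r * (C * \<gamma>0\<^sup>2) + B * \<kappa>"
        using r by (simp add: \<theta>(2) distrib_left)
      moreover have "real r * I\<^sub>R = real r * (\<gamma>0 * \<bar>J\<bar>) - real r * (C * \<gamma>0\<^sup>2)"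
        by (simp add: I\<^sub>R_def info_rate_def right_diff_distrib)
      moreover have "I\<^sub>R / 2 * real r = real r * I\<^sub>R / 2"
        by simp
      ultimately show ?thesis
        using drift unfolding exp_le_cancel_iff by linarith
    qed
    ultimately have mix: "ennreal (exp (I\<^sub>R / 2 * real r - B * \<kappa>) * (c\<^sub>Q * (\<kappa> / real r)))
        \<le> mixture Q f (x, l) (T + 1) (T + r)"
      using constants_pos pos
      by (elim order_trans[rotated]) (intro ennreal_leI mult_right_mono; simp)
    \<comment> \<open>The barrier is infinite when the weight vanishes, so a finite bound on it
      forces a positive weight.\<close>
    have w_pos: "w (T + 1) > 0" and "ln (b / w (T + 1)) \<le> I\<^sub>R / 2 * real r - ln (real r) - c0"
      using barrier w by (auto simp: log_barrier_def split: if_splits)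
    hence "ln (b / w (T + 1)) \<le> I\<^sub>R / 2 * real r - B * \<kappa> + (ln (c\<^sub>Q * \<kappa>) - ln (real r))"
      by (simp add: c0_def)
    also have "\<dots> = ln (exp (I\<^sub>R / 2 * real r - B * \<kappa>) * (c\<^sub>Q * (\<kappa> / real r)))"
      using r constants_pos pos by (simp add: ln_mult ln_div)
    finally have "b / w (T + 1) \<le> exp (I\<^sub>R / 2 * real r - B * \<kappa>) * (c\<^sub>Q * (\<kappa> / real r))"
      using b w_pos r constants_pos pos by (subst (asm) ln_le_cancel_iff) auto
    hence "b \<le> w (T + 1) * (exp (I\<^sub>R / 2 * real r - B * \<kappa>) * (c\<^sub>Q * (\<kappa> / real r)))"
      using w_pos by (simp add: pos_divide_le_eq mult.commute)
    hence "ennreal b \<le> ennreal (w (T + 1)) * ennreal (exp (I\<^sub>R / 2 * real r - B * \<kappa>) * (c\<^sub>Q * (\<kappa> / real r)))"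
      using w_pos by (subst ennreal_mult'[symmetric]) (auto intro: ennreal_leI)
    also have "\<dots> \<le> ennreal (w (T + 1)) * mixture Q f (x, l) (T + 1) (T + r)"
      using mix by (intro mult_left_mono) auto
    finally show ?thesis .
  qed

  \<comment> \<open>Exponential bound on the bad event\<close>
  \<comment> \<open>\<open>R\<close> stays abstract so that one bound covers both stopping
    times.\<close>
  have late: "\<P>(\<omega> in row_law P0 T P1. R \<omega>) \<le> c1 * exp (- c2 * real r)"
    if T: "1 \<le> T" and r: "1 \<le> r" "real r \<le> \<delta>0 * real T"
      and w: "w (T + 1) \<ge> 0" and b: "b > 0"
      and barrier: "log_barrier w T b \<le> ereal (I\<^sub>R / 2 * real r - ln (real r) - c0)"
      and R: "\<And>\<omega>. R \<omega> \<Longrightarrow> ennreal (w (T + 1)) * mixture Q f \<omega> (T + 1) (T + r) < ennreal b"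
    for T r :: nat and b :: real and w R
  proof -
    let ?M = "\<lambda>j. if j \<le> T then P0 else P1"
    let ?X = "PiM {1..} ?M"
    let ?pre = "\<lambda>q. {x \<in> space ?X. real T * \<eta> \<le> \<bar>(\<Sum>i=1..T. of_bool (x i \<le> q)) - real T * ?F q\<bar>}"
    let ?post = "{x \<in> space ?X. real r * \<epsilon> \<le> \<bar>(\<Sum>j=T+1..T+r. \<phi> (x j)) - real r * J\<bar>}"
    have rT: "real r \<le> real T"
      using r(2) pos mult_right_mono[of \<delta>0 1 "real T"] by simp
    have M: "prob_space (?M j)" for j
      using P0 P1 by simp
    interpret X: prob_space ?X
      by (intro prob_space_PiM M)
    have coord: "(\<lambda>x. x j) \<in> borel_measurable ?X" if "j \<ge> 1" for j
    proof -
      have "(\<lambda>x. x j) \<in> measurable ?X (?M j)"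
        using that by (intro measurable_component_singleton) auto
      moreover have "sets (?M j) = sets borel"
        by simp
      ultimately show ?thesis
        using measurable_cong_sets by blast
    qed
    have pre_sets: "?pre q \<in> sets ?X" for q
    proof -
      have "(\<lambda>y. of_bool (y \<le> q) :: real) = indicator {..q}"
        by (auto simp: fun_eq_iff indicator_def)
      hence le_q: "(\<lambda>y. of_bool (y \<le> q) :: real) \<in> borel_measurable borel"
        by simp
      have "(\<lambda>x. of_bool (x i \<le> q) :: real) \<in> borel_measurable ?X" if "i \<in> {1..T}" for i
        using that by (intro measurable_compose[OF coord le_q]) auto
      thus ?thesis
        by measurable
    qed
    have pre_union: "(\<Union>q\<in>S. ?pre q) \<in> sets ?X"
      by (rule sets.finite_UN[OF S(1) pre_sets])
    have post_sets: "?post \<in> sets ?X"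
    proof -
      have "(\<lambda>x. \<phi> (x j)) \<in> borel_measurable ?X" if "j \<in> {T+1..T+r}" for j
        using measurable_compose[OF coord borel_measurable_continuous_onI[OF \<phi>_cont]] that by auto
      thus ?thesis
        by measurable
    qed
    \<comment> \<open>Hoeffding gives a rate in \<open>T\<close>, which is also a rate in
      \<open>r\<close> because \<open>r \<le> T\<close>. Indicators are bounded by 1.\<close>
    have pre: "measure ?X (?pre q) \<le> 2 * exp (- c2 * real r)" for q
    proof -
      have c2_le: "c2 * real r \<le> \<eta>\<^sup>2 / 2 * real T"
        using rT by (intro mult_mono) (auto simp: c2_def)
      have ind: "of_bool (y \<le> q) = (indicator {..q} y :: real)" for y
        by (simp add: indicator_def)
      have F: "(LINT y|P0. indicator {..q} y) = ?F q"
        by (simp add: cdf_def)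
      have "measure ?X {x \<in> space ?X. real (card {1..T}) * \<eta>
          \<le> \<bar>(\<Sum>i\<in>{1..T}. indicator {..q} (x i)) - real (card {1..T}) * (LINT y|P0. indicator {..q} y)\<bar>}
          \<le> 2 * exp (- (\<eta>\<^sup>2 / (2 * 1\<^sup>2)) * real (card {1..T}))"
        using M T pos by (intro Hoeffding_PiM) (auto simp: indicator_def)
      also have "\<dots> \<le> 2 * exp (- c2 * real r)"
        using c2_le by simp
      finally show ?thesis
        unfolding F ind by simp
    qed
    \<comment> \<open>The p-values share the whole past sample, whereas the
      \<open>\<phi> (x j)\<close> are independent with mean \<open>J\<close>; hence the detour
      through population ranks.\<close>
    have post: "measure ?X ?post \<le> 2 * exp (- c2 * real r)"
    proof -
      have c2_le: "c2 * real r \<le> \<epsilon>\<^sup>2 / (2 * K\<^sup>2) * real r"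
        by (intro mult_right_mono) (auto simp: c2_def)
      have "measure ?X {x \<in> space ?X. real (card {T+1..T+r}) * \<epsilon>
          \<le> \<bar>(\<Sum>j\<in>{T+1..T+r}. \<phi> (x j)) - real (card {T+1..T+r}) * (LINT y|P1. \<phi> y)\<bar>}
          \<le> 2 * exp (- (\<epsilon>\<^sup>2 / (2 * K\<^sup>2)) * real (card {T+1..T+r}))"
        using M r pos K F01 \<phi>_cont
        by (intro Hoeffding_PiM P1.measurable_finite_borel borel_measurable_continuous_onI) (auto simp: \<phi>_def)
      also have "\<dots> \<le> 2 * exp (- c2 * real r)"
        using c2_le by simp
      finally show ?thesis
        by (simp add: mean_\<phi>)
    qed
    have "\<P>(\<omega> in row_law P0 T P1. R \<omega>) \<le> measure ?X ((\<Union>q\<in>S. ?pre q) \<union> ?post)"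
    proof (rule measure_row_law_le)
      show "(\<Union>q\<in>S. ?pre q) \<union> ?post \<in> sets ?X"
        by (rule sets.Un[OF pre_union post_sets])
    next
      fix x l assume x: "x \<in> space ?X" and l: "\<And>j. j \<ge> 1 \<Longrightarrow> 0 \<le> l j \<and> l j \<le> 1" and "R (x, l)"
      show "x \<in> (\<Union>q\<in>S. ?pre q) \<union> ?post"
      \<comment> \<open>Outside both kinds of bad event detection is certain, which contradicts
        \<open>R\<close>.\<close>
      proof (rule ccontr)
        assume nb: "x \<notin> (\<Union>q\<in>S. ?pre q) \<union> ?post"
        have "ennreal b \<le> ennreal (w (T + 1)) * mixture Q f (x, l) (T + 1) (T + r)"
        proof (rule detect[OF T r l _ _ w b barrier])
          fix q assume "q \<in> S"
          hence "x \<notin> ?pre q"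
            using nb by blast
          thus "\<bar>(\<Sum>i=1..T. of_bool (x i \<le> q)) - real T * ?F q\<bar> \<le> real T * \<eta>"
            using x by simp
        next
          have "x \<notin> ?post"
            using nb by blast
          thus "\<bar>(\<Sum>j=T+1..T+r. \<phi> (x j)) - real r * J\<bar> \<le> real r * \<epsilon>"
            using x by simp
        qed
        thus False
          using R[OF \<open>R (x, l)\<close>] by simp
      qed
    qed (rule P0 P1)+
    also have "\<dots> \<le> measure ?X (\<Union>q\<in>S. ?pre q) + measure ?X ?post"
      by (rule measure_Un_le[OF pre_union post_sets])
    also have "\<dots> \<le> (\<Sum>q\<in>S. measure ?X (?pre q)) + measure ?X ?post"
      by (rule add_right_mono[OF measure_UNION_le[OF S(1) pre_sets]])
    also have "\<dots> \<le> (\<Sum>q\<in>S. 2 * exp (- c2 * real r)) + 2 * exp (- c2 * real r)"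
      by (intro add_mono sum_mono pre post)
    also have "\<dots> = c1 * exp (- c2 * real r)"
      by (simp add: c1_def algebra_simps)
    finally show ?thesis .
  qed

  \<comment> \<open>Conclusion for both detectors\<close>
  show ?thesis
  proof (rule exI[of _ c0], rule exI[of _ c1], rule exI[of _ c2], rule exI[of _ \<delta>0],
      intro conjI allI impI)
    fix T :: "nat \<Rightarrow> nat" and w b :: "nat \<Rightarrow> real"
    assume T: "\<forall>n\<ge>1. T n \<ge> 1" and w: "\<forall>k\<ge>1. w k \<ge> 0" and b: "\<forall>n\<ge>1. b n > 0"
    show "\<forall>\<^sub>F n in sequentially. \<forall>r::nat.
          1 \<le> r \<longrightarrow> real r \<le> \<delta>0 * real (T n) \<longrightarrow>
          ereal (I\<^sub>R / 2 * real r - ln (real r) - c0) \<ge> log_barrier w (T n) (b n) \<longrightarrow>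
          \<P>(\<omega> in row_law P0 (T n) P1. tau_S Q f w (b n) \<omega> > enat (T n + r)) \<le> c1 * exp (- c2 * real r) \<and>
          \<P>(\<omega> in row_law P0 (T n) P1. tau_Z Q f w (b n) \<omega> > enat (T n + r)) \<le> c1 * exp (- c2 * real r)"
    \<comment> \<open>Positivity of \<open>T n\<close> and \<open>b n\<close> is given from index 1
      on, hence the start at \<open>n = 1\<close>.\<close>
    proof (rule eventually_mono[OF eventually_ge_at_top[of 1]], intro allI impI)
      fix n r :: nat
      assume n: "1 \<le> n" and r: "1 \<le> r" "real r \<le> \<delta>0 * real (T n)"
        and barrier: "log_barrier w (T n) (b n) \<le> ereal (I\<^sub>R / 2 * real r - ln (real r) - c0)"
      have Tn: "1 \<le> T n" and wn: "0 \<le> w (T n + 1)" and bn: "0 < b n"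
        using T w b n by auto
      note late_n = late[OF Tn r wn bn barrier]
      show "\<P>(\<omega> in row_law P0 (T n) P1. tau_S Q f w (b n) \<omega> > enat (T n + r)) \<le> c1 * exp (- c2 * real r) \<and>
        \<P>(\<omega> in row_law P0 (T n) P1. tau_Z Q f w (b n) \<omega> > enat (T n + r)) \<le> c1 * exp (- c2 * real r)"
        by (intro conjI; rule late_n; (erule tau_S_gt tau_Z_gt); use r in simp)
    qed
  qed (use pos c2 in \<open>auto simp: c0_def c1_def\<close>)
qed

end
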